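(* Let $n$ be a positive integer and let $\psi:\mathbb{R}^n\to\mathbb{R}$ be a $C^2$ function whose entire graph $\Gamma_\psi$ in the Lorentz-Minkowski space $\mathbb{R}^{n+1}_1$ is space-like or time-like. If $\Gamma_\psi$ has constant mean curvature $H$ and there exist constants $M>0$ and $\varepsilon>0$ such that $$\frac{|\nabla\psi|}{\sqrt{\bigl|1-|\nabla\psi|^2\bigr|}}\le M\bigl((u^1)^2+\cdots+(u^n)^2\bigr)^{(1/2)-\varepsilon}\quad\text{on }\mathbb{R}^n,$$ then $H\equiv 0$.
   Context: $\mathbb{R}^{n+1}_1$ is $\mathbb{R}^{n+1}$ with the Lorentz metric $\langle x,y\rangle_L=x^1y^1+\cdots+x^ny^n-x^{n+1}y^{n+1}$. The entire graph of a $C^2$ function $\psi:\mathbb{R}^n\to\mathbb{R}$ is $\Gamma_\psi=\{(u,\psi(u)) : u\in\mathbb{R}^n\}\subset\mathbb{R}^{n+1}_1$, and $\nabla\psi=(\psi_{u^1},\ldots,\psi_{u^n})$ is the Euclidean gradient, with Euclidean norm $|\nabla\psi|$. The graph is space-like (induced metric Riemannian) when $|\nabla\psi|<1$ everywhere, and time-like (induced metric Lorentzian) when $|\nabla\psi|>1$ everywhere. The mean curvature $H$ of $\Gamma_\psi$, regarded as a function on $\mathbb{R}^n$, is given by $$nH=\operatorname{div}\left(\frac{\nabla\psi}{\sqrt{1-|\nabla\psi|^2}}\right)\ \text{(space-like case)},\qquad nH=\operatorname{div}\left(\frac{\nabla\psi}{\sqrt{|\nabla\psi|^2-1}}\right)\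 \text{(time-like case)}.$$ Convention at the origin: for an exponent $k$, $0^k=0$ if $k>0$, $0^0=1$, and $0^k=+\infty$ if $k<0$ (so the bound imposes no condition at the origin when $k<0$). *)

theory Defs
  imports "HOL-Analysis.Analysis"
begin

definition partial_deriv :: "'n::finite \<Rightarrow> (real^'n \<Rightarrow> real) \<Rightarrow> real^'n \<Rightarrow> real" where
  "partial_deriv i f u = frechet_derivative f (at u) (axis i 1)"

definition grad :: "(real^'n \<Rightarrow> real) \<Rightarrow> real^'n::finite \<Rightarrow> real^'n" where
  "grad f u = (\<chi> i. partial_deriv i f u)"

definition divergence :: "(real^'n \<Rightarrow> real^'n) \<Rightarrow> real^'n::finite \<Rightarrow> real" where
  "divergence X u = (\<Sum>i\<in>UNIV. partial_deriv i (\<lambda>v. X v $ i) u)"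

definition C1_function :: "(real^'n::finite \<Rightarrow> real) \<Rightarrow> bool" where
  "C1_function f \<longleftrightarrow>
     (\<forall>u. f differentiable (at u)) \<and> (\<forall>i. continuous_on UNIV (partial_deriv i f))"

definition C2_function :: "(real^'n::finite \<Rightarrow> real) \<Rightarrow> bool" where
  "C2_function f \<longleftrightarrow>
     (\<forall>u. f differentiable (at u)) \<and> (\<forall>i. C1_function (partial_deriv i f))"

text \<open>The Lorentz-Minkowski space of dimension \<open>n + 1\<close> is represented by the product
  \<^typ>\<open>real^'n \<times> real\<close>, the second factor being the time coordinate. The product type also
  carries the Euclidean inner product, which is not used for the ambient metric.\<close>

definition lorentz_inner :: "(real^'n) \<times> real \<Rightarrow> (real^'n::finite) \<times> real \<Rightarrow> real" where
  "lorentz_inner x y = (\<Sum>i\<in>UNIV. fst x $ i * fst y $ i) - snd x * snd y"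

definition graph_map :: "(real^'n \<Rightarrow> real) \<Rightarrow> real^'n::finite \<Rightarrow> (real^'n) \<times> real" where
  "graph_map \<psi> u = (u, \<psi> u)"

text \<open>The metric induced on the entire graph, in the coordinates given by \<^const>\<open>graph_map\<close>.\<close>

definition induced_metric ::
    "(real^'n \<Rightarrow> real) \<Rightarrow> real^'n::finite \<Rightarrow> real^'n \<Rightarrow> real^'n \<Rightarrow> real" where
  "induced_metric \<psi> u v w =
     lorentz_inner (frechet_derivative (graph_map \<psi>) (at u) v)
                   (frechet_derivative (graph_map \<psi>) (at u) w)"

definition positive_definite_form :: "(real^'n::finite \<Rightarrow> real^'n \<Rightarrow> real) \<Rightarrow> bool" where
  "positive_definite_form g \<longleftrightarrow> (\<forall>v. v \<noteq> 0 \<longrightarrow> g v v > 0)"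

text \<open>A Lorentzian form is a nondegenerate form of index one: the maximal dimension of a
  negative definite subspace is one. In dimension one it is a negative definite form.\<close>

definition lorentzian_form :: "(real^'n::finite \<Rightarrow> real^'n \<Rightarrow> real) \<Rightarrow> bool" where
  "lorentzian_form g \<longleftrightarrow>
     (\<forall>v. (\<forall>w. g v w = 0) \<longrightarrow> v = 0) \<and>
     (\<exists>v. g v v < 0) \<and>
     (\<forall>S. subspace S \<and> (\<forall>v\<in>S. v \<noteq> 0 \<longrightarrow> g v v < 0) \<longrightarrow> dim S \<le> 1)"

definition spacelike_graph :: "(real^'n::finite \<Rightarrow> real) \<Rightarrow> bool" where
  "spacelike_graph \<psi> \<longleftrightarrow> (\<forall>u. positive_definite_form (induced_metric \<psi> u))"

definition timelike_graph :: "(real^'n::finite \<Rightarrow> real) \<Rightarrow> bool" where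
  "timelike_graph \<psi> \<longleftrightarrow> (\<forall>u. lorentzian_form (induced_metric \<psi> u))"

text \<open>The mean curvature of the entire graph as a function on the domain of \<open>\<psi>\<close>; it is meaningful
  when the graph is space-like (first branch) or time-like (second branch).\<close>

definition mean_curvature :: "(real^'n \<Rightarrow> real) \<Rightarrow> real^'n::finite \<Rightarrow> real" where
  "mean_curvature \<psi> u =
     (if spacelike_graph \<psi>
      then divergence (\<lambda>v. (1 / sqrt (1 - (norm (grad \<psi> v))\<^sup>2)) *\<^sub>R grad \<psi> v) u
      else divergence (\<lambda>v. (1 / sqrt ((norm (grad \<psi> v))\<^sup>2 - 1)) *\<^sub>R grad \<psi> v) u)
     / real CARD('n)"

text \<open>Real powers of a nonnegative base with \<open>0\<^sup>0 = 1\<close> and \<open>0\<^sup>k = \<infinity>\<close> for \<open>k < 0\<close>, in contrast to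
  \<^const>\<open>powr\<close>, for which every power of \<open>0\<close> is \<open>0\<close>.\<close>

definition ext_power :: "real \<Rightarrow> real \<Rightarrow> ereal" where
  "ext_power x k =
     (if x = 0 then (if k > 0 then 0 else if k = 0 then 1 else \<infinity>) else ereal (x powr k))"

text \<open>The causal character in terms of the Euclidean gradient.\<close>

lemma frechet_derivative_eq_grad:
  fixes f :: "real^'n::finite \<Rightarrow> real"
  assumes "f differentiable (at u)"
  shows "frechet_derivative f (at u) v = grad f u \<bullet> v"
proof -
  have lin: "linear (frechet_derivative f (at u))"
    using assms by (rule linear_frechet_derivative)
  have "frechet_derivative f (at u) v
      = frechet_derivative f (at u) (\<Sum>i\<in>UNIV. (v $ i) *\<^sub>R axis i 1)"
    using basis_expansion[of v] by (simp add: scalar_mult_eq_scaleR)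
  also have "\<dots> = (\<Sum>i\<in>UNIV. v $ i * frechet_derivative f (at u) (axis i 1))"
    using lin by (simp add: linear_sum linear_scale)
  finally show ?thesis
    by (simp add: grad_def partial_deriv_def inner_vec_def mult.commute)
qed

lemma induced_metric_eq:
  fixes \<psi> :: "real^'n::finite \<Rightarrow> real"
  assumes "\<psi> differentiable (at u)"
  shows "induced_metric \<psi> u v w = v \<bullet> w - (grad \<psi> u \<bullet> v) * (grad \<psi> u \<bullet> w)"
proof -
  have "(graph_map \<psi> has_derivative (\<lambda>v. (v, frechet_derivative \<psi> (at u) v))) (at u)"
    unfolding graph_map_def[abs_def]
    using assms by (auto intro!: derivative_eq_intros simp: frechet_derivative_works[symmetric])
  then have "frechet_derivative (graph_map \<psi>) (at u) = (\<lambda>v. (v, frechet_derivative \<psi> (at u) v))"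
    by (rule frechet_derivative_at[symmetric])
  then show ?thesis
    by (simp add: induced_metric_def lorentz_inner_def inner_vec_def
        frechet_derivative_eq_grad[OF assms])
qed

lemma spacelike_graph_iff:
  fixes \<psi> :: "real^'n::finite \<Rightarrow> real"
  assumes "\<And>u. \<psi> differentiable (at u)"
  shows "spacelike_graph \<psi> \<longleftrightarrow> (\<forall>u. norm (grad \<psi> u) < 1)"
proof -
  have "(\<forall>v. v \<noteq> 0 \<longrightarrow> v \<bullet> v - (p \<bullet> v) * (p \<bullet> v) > 0) \<longleftrightarrow> norm p < 1" for p :: "real^'n"
  proof
    assume L: "\<forall>v. v \<noteq> 0 \<longrightarrow> v \<bullet> v - (p \<bullet> v) * (p \<bullet> v) > 0"
    show "norm p < 1"
    proof (cases "p = 0")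
      case False
      then have "(p \<bullet> p) * (1 - p \<bullet> p) > 0" using L by (auto simp: algebra_simps)
      moreover have "p \<bullet> p > 0" using False by simp
      ultimately have "p \<bullet> p < 1" by (simp add: zero_less_mult_iff)
      then show ?thesis by (simp add: norm_eq_sqrt_inner)
    qed simp
  next
    assume R: "norm p < 1"
    show "\<forall>v. v \<noteq> 0 \<longrightarrow> v \<bullet> v - (p \<bullet> v) * (p \<bullet> v) > 0"
    proof (intro allI impI)
      fix v :: "real^'n" assume v: "v \<noteq> 0"
      have "\<bar>p \<bullet> v\<bar> \<le> norm p * norm v" by (rule Cauchy_Schwarz_ineq2)
      also have "\<dots> < norm v" using R v by simp
      finally have "\<bar>p \<bullet> v\<bar>\<^sup>2 < (norm v)\<^sup>2" by (intro power_strict_mono) auto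
      then show "v \<bullet> v - (p \<bullet> v) * (p \<bullet> v) > 0"
        by (simp add: dot_square_norm power2_eq_square)
    qed
  qed
  then show ?thesis
    by (simp add: spacelike_graph_def positive_definite_form_def induced_metric_eq[OF assms])
qed

lemma timelike_graph_iff:
  fixes \<psi> :: "real^'n::finite \<Rightarrow> real"
  assumes "\<And>u. \<psi> differentiable (at u)"
  shows "timelike_graph \<psi> \<longleftrightarrow> (\<forall>u. norm (grad \<psi> u) > 1)"
proof -
  have "lorentzian_form (\<lambda>v w. v \<bullet> w - (p \<bullet> v) * (p \<bullet> w)) \<longleftrightarrow> norm p > 1" for p :: "real^'n"
  proof
    assume "lorentzian_form (\<lambda>v w. v \<bullet> w - (p \<bullet> v) * (p \<bullet> w))"
    then obtain v where "v \<bullet> v < (p \<bullet> v) * (p \<bullet> v)"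
      by (auto simp: lorentzian_form_def)
    then have "(norm v)\<^sup>2 < \<bar>p \<bullet> v\<bar>\<^sup>2"
      by (simp add: dot_square_norm power2_eq_square)
    then have "norm v < \<bar>p \<bullet> v\<bar>" by (rule power_less_imp_less_base) simp
    also have "\<dots> \<le> norm p * norm v" by (rule Cauchy_Schwarz_ineq2)
    finally have "0 < (norm p - 1) * norm v" by (simp add: algebra_simps)
    then show "norm p > 1" by (simp add: zero_less_mult_iff)
  next
    assume R: "norm p > 1"
    then have pp: "p \<bullet> p > 1" by (simp add: norm_eq_sqrt_inner)
    have nondeg: "v = 0" if "\<forall>w. v \<bullet> w - (p \<bullet> v) * (p \<bullet> w) = 0" for v
    proof -
      have "p \<bullet> v = (p \<bullet> v) * (p \<bullet> p)" using that[rule_format, of p] by (simp add: inner_commute)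
      then have "p \<bullet> v = 0" using pp by auto
      then show ?thesis using that[rule_format, of v] by simp
    qed
    have neg: "p \<bullet> p - (p \<bullet> p) * (p \<bullet> p) < 0"
    proof -
      have "(p \<bullet> p) * 1 < (p \<bullet> p) * (p \<bullet> p)"
        using pp by (intro mult_strict_left_mono) linarith+
      then show ?thesis by linarith
    qed
    have index: "dim S \<le> 1"
      if S: "subspace S" "\<forall>v\<in>S. v \<noteq> 0 \<longrightarrow> v \<bullet> v - (p \<bullet> v) * (p \<bullet> v) < 0" for S
    proof -
      have lin: "linear ((\<bullet>) p)" by (rule bounded_linear.linear[OF bounded_linear_inner_right])
      have "v = 0" if "v \<in> S" "p \<bullet> v = 0" for v
        using S(2) that by (metis diff_zero inner_ge_zero mult_zero_left not_less)
      then have "inj_on ((\<bullet>) p) S"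
        using linear_injective_on_subspace_0[OF lin S(1)] by auto
      then have "dim S = dim ((\<bullet>) p ` S)"
        using lin S(1) by (metis dim_image_eq span_eq_iff)
      also have "\<dots> \<le> DIM(real)" by (rule dim_subset_UNIV)
      finally show ?thesis by simp
    qed
    show "lorentzian_form (\<lambda>v w. v \<bullet> w - (p \<bullet> v) * (p \<bullet> w))"
      unfolding lorentzian_form_def using nondeg neg index by blast
  qed
  then show ?thesis
    unfolding timelike_graph_def by (simp add: induced_metric_eq[OF assms, abs_def])
qed

end

theory Submission imports Defs begin

text \<open>The field \<open>X = \<nabla>\<psi> / sqrt \<bar>1 - \<bar>\<nabla>\<psi>\<bar>\<^sup>2\<bar>\<close> is \<open>C\<^sup>1\<close>, has constant divergence \<open>c = n H\<close>, and grows
  at most like \<open>\<bar>u\<bar>\<close> to a power less than 1. Its flux through the boundary of the cube \<open>[-L, L]\<^sup>n\<close> is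
  therefore \<open>o(L\<^sup>n)\<close>, whereas it equals \<open>c (2 L)\<^sup>n\<close>; so \<open>c = 0\<close>.

  The flux bound needs no divergence theorem: the integral of \<open>\<partial>\<^sub>i f\<close> over the cube is the derivative at
  \<open>h = 0\<close> of the integral of \<open>f\<close> over the cube translated by \<open>h e\<^sub>i\<close>, and the translated cube differs
  from the original one by two slabs of thickness \<open>h\<close>.\<close>

section \<open>Calculus of \<open>C1_function\<close>: closure properties obtained by exhibiting a
  continuous gradient\<close>

lemma has_derivative_inner_imp_C1_function:
  fixes f :: "real^'n::finite \<Rightarrow> real"
  assumes "\<And>u. (f has_derivative (\<lambda>v. g u \<bullet> v)) (at u)" and "continuous_on UNIV g"
  shows "C1_function f"
proof -
  have "partial_deriv i f = (\<lambda>u. g u $ i)" for i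
    by (rule ext)
      (simp add: partial_deriv_def frechet_derivative_at[OF assms(1), symmetric] inner_axis)
  moreover have "continuous_on UNIV (\<lambda>u. g u $ i)" for i
    by (intro continuous_intros assms)
  ultimately show ?thesis
    using assms(1) by (auto simp: C1_function_def differentiable_def)
qed

lemma C1_function_has_derivative:
  assumes "C1_function f"
  shows "(f has_derivative (\<lambda>v. grad f u \<bullet> v)) (at u)"
proof -
  have d: "f differentiable (at u)"
    using assms by (simp add: C1_function_def)
  have "frechet_derivative f (at u) = (\<lambda>v. grad f u \<bullet> v)"
    by (rule ext) (rule frechet_derivative_eq_grad[OF d])
  then show ?thesis
    using d frechet_derivative_works by metis
qed

lemma C1_function_continuous_grad: "C1_function f \<Longrightarrow> continuous_on UNIV (grad f)"
  unfolding grad_def[abs_def] C1_function_def by (intro continuous_on_vec_lambda) auto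

lemma C1_function_continuous: "C1_function f \<Longrightarrow> continuous_on UNIV f"
  using C1_function_has_derivative has_derivative_continuous
  by (metis continuous_at_imp_continuous_on)

lemma C1_function_const: "C1_function (\<lambda>u. c)"
  by (rule has_derivative_inner_imp_C1_function[where g="\<lambda>u. 0"]) auto

lemma C1_function_add:
  assumes "C1_function f" "C1_function g"
  shows "C1_function (\<lambda>u. f u + g u)"
  by (rule has_derivative_inner_imp_C1_function[where g="\<lambda>u. grad f u + grad g u"])
    (auto simp: inner_add_left assms
      intro!: derivative_eq_intros continuous_intros C1_function_has_derivative
        C1_function_continuous_grad)

lemma C1_function_mult:
  assumes "C1_function f" "C1_function g"
  shows "C1_function (\<lambda>u. f u * g u)"
proof (rule has_derivative_inner_imp_C1_function
    [where g="\<lambda>u. f u *\<^sub>R grad g u + g u *\<^sub>R grad f u"])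
  show "((\<lambda>u. f u * g u) has_derivative
      (\<lambda>v. (f u *\<^sub>R grad g u + g u *\<^sub>R grad f u) \<bullet> v)) (at u)" for u
    by (rule has_derivative_eq_rhs[OF has_derivative_mult[OF
            C1_function_has_derivative[OF assms(1)] C1_function_has_derivative[OF assms(2)]]])
      (simp add: inner_add_left mult.commute)
qed (intro continuous_intros assms C1_function_continuous C1_function_continuous_grad)

lemma C1_function_sum:
  assumes "\<And>i. i \<in> I \<Longrightarrow> C1_function (f i)"
  shows "C1_function (\<lambda>u. \<Sum>i\<in>I. f i u)"
  using assms
  by (induction I rule: infinite_finite_induct) (auto intro: C1_function_const C1_function_add)

text \<open>The set \<open>S\<close> confines the demands on the outer function to values that
  \<open>f\<close> takes, as needed for \<open>1 / sqrt s\<close>, which is smooth only for positive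
  \<open>s\<close>.\<close>

lemma C1_function_compose:
  fixes f :: "real^'n::finite \<Rightarrow> real"
  assumes f: "C1_function f" and rng: "\<And>u. f u \<in> S"
    and phi: "\<And>s. s \<in> S \<Longrightarrow> (\<phi> has_real_derivative \<phi>' s) (at s)" "continuous_on S \<phi>'"
  shows "C1_function (\<lambda>u. \<phi> (f u))"
proof (rule has_derivative_inner_imp_C1_function[where g="\<lambda>u. \<phi>' (f u) *\<^sub>R grad f u"])
  show "((\<lambda>u. \<phi> (f u)) has_derivative (\<lambda>v. (\<phi>' (f u) *\<^sub>R grad f u) \<bullet> v)) (at u)" for u
    using has_derivative_compose[OF C1_function_has_derivative[OF f, of u]
        phi(1)[OF rng, unfolded has_field_derivative_def]]
    by simp
  show "continuous_on UNIV (\<lambda>u. \<phi>' (f u) *\<^sub>R grad f u)"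
    using rng
    by (intro continuous_intros C1_function_continuous_grad f
        continuous_on_compose2[OF phi(2)] C1_function_continuous) auto
qed

lemma C1_function_inverse_sqrt:
  assumes "C1_function f" and "\<And>u. f u > 0"
  shows "C1_function (\<lambda>u. 1 / sqrt (f u))"
proof (rule C1_function_compose[OF assms(1), where S="{0<..}"])
  show "((\<lambda>s. 1 / sqrt s) has_real_derivative - (1 / (2 * s * sqrt s))) (at s)"
    if "s \<in> {0<..}" for s :: real
    using that by (auto intro!: derivative_eq_intros simp: field_simps)
  show "continuous_on {0<..} (\<lambda>s::real. - (1 / (2 * s * sqrt s)))"
    by (intro continuous_intros) auto
qed (use assms in auto)

section \<open>Translated cubes and the flux bound\<close>

lemma C1_function_has_directional_derivative:
  fixes f :: "real^'n::finite \<Rightarrow> real"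
  assumes "C1_function f"
  shows "((\<lambda>h. f (u + h *\<^sub>R axis i 1)) has_real_derivative
    partial_deriv i f (u + h *\<^sub>R axis i 1)) (at h within S)"
proof -
  have "((\<lambda>h. u + h *\<^sub>R axis i 1) has_derivative (\<lambda>h. h *\<^sub>R axis i 1)) (at h within S)"
    by (auto intro!: derivative_eq_intros)
  from has_derivative_compose[OF this C1_function_has_derivative[OF assms]]
  show ?thesis
    unfolding has_field_derivative_def
    by (rule has_derivative_eq_rhs) (simp add: fun_eq_iff inner_axis grad_def mult.commute)
qed

text \<open>The difference quotients from the right are bounded by \<open>K\<close>, and a one-sided
  limit already determines \<open>D\<close>. Hence the cube has to be translated in the positive
  direction only.\<close>

lemma abs_derivative_le_of_right_lipschitz:
  fixes F :: "real \<Rightarrow> real"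
  assumes D: "(F has_real_derivative D) (at x)" and "d > 0"
    and F: "\<And>h. 0 < h \<Longrightarrow> h < d \<Longrightarrow> \<bar>F (x + h) - F x\<bar> \<le> K * h"
  shows "\<bar>D\<bar> \<le> K"
proof -
  have "((\<lambda>h. (F (x + h) - F x) / h) \<longlongrightarrow> D) (at_right 0)"
    using D unfolding DERIV_def
    by (rule filterlim_mono[OF _ order_refl]) (simp add: at_le)
  then have "((\<lambda>h. \<bar>(F (x + h) - F x) / h\<bar>) \<longlongrightarrow> \<bar>D\<bar>) (at_right 0)"
    by (rule tendsto_rabs)
  moreover have "\<forall>\<^sub>F h in at_right 0. \<bar>(F (x + h) - F x) / h\<bar> \<le> K"
    using eventually_at_right_real[OF \<open>d > 0\<close>]
    by eventually_elim (use F in \<open>auto simp: field_simps\<close>)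
  ultimately show ?thesis
    by (rule tendsto_upperbound) simp
qed

text \<open>Each of the two slabs contributes at most \<open>B * h / (2 * L)\<close> times the
  volume of \<open>Q\<close>; dividing the total by \<open>h\<close> leaves \<open>B / L\<close>.
  The bound on \<open>f\<close> is asked for only on a shell that contains the slabs and avoids the
  origin, where a growth bound with negative exponent says nothing.\<close>

lemma integral_partial_deriv_cube_bound:
  fixes f :: "real^'n::finite \<Rightarrow> real"
  assumes f: "C1_function f" and L: "L > 0" and "B \<ge> 0"
    and B: "\<And>u. L / 2 \<le> norm u \<Longrightarrow> norm u \<le> 2 * real CARD('n) * L \<Longrightarrow> \<bar>f u\<bar> \<le> B"
  defines "Q \<equiv> cbox (\<chi> j. - L) (\<chi> j. L)"
  shows "\<bar>integral Q (partial_deriv i f)\<bar> \<le> B / L * measure lborel Q"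
proof -
  define e :: "real^'n" where "e = axis i 1"
  define F where "F h = integral Q (\<lambda>u. f (u + h *\<^sub>R e))" for h
  have cont: "continuous_on UNIV f" and cont': "continuous_on UNIV (partial_deriv i f)"
    using f by (auto simp: C1_function_continuous C1_function_def)
  have int: "f integrable_on cbox p q" for p q
    by (rule integrable_continuous) (rule continuous_on_subset[OF cont subset_UNIV])
  \<comment> \<open>Differentiation under the integral sign, with the translation length as
    parameter.\<close>
  have "(F has_real_derivative integral Q (\<lambda>u. partial_deriv i f (u + 0 *\<^sub>R e))) (at 0 within UNIV)"
    unfolding F_def Q_def
  proof (rule leibniz_rule_field_derivative)
    show "((\<lambda>h. f (u + h *\<^sub>R e)) has_real_derivative partial_deriv i f (u + h *\<^sub>R e))
        (at h within UNIV)" for h u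
      unfolding e_def by (rule C1_function_has_directional_derivative[OF f])
    show "(\<lambda>u. f (u + h *\<^sub>R e)) integrable_on cbox (\<chi> j. - L) (\<chi> j. L)" for h
      by (intro integrable_continuous continuous_on_compose2[OF cont] continuous_intros) auto
    show "continuous_on (UNIV \<times> cbox (\<chi> j. - L) (\<chi> j. L))
        (\<lambda>(h, u). partial_deriv i f (u + h *\<^sub>R e))"
      unfolding split_beta
      by (intro continuous_on_compose2[OF cont'] continuous_intros) auto
  qed auto
  then have deriv: "(F has_real_derivative integral Q (partial_deriv i f)) (at 0)"
    by simp
  \<comment> \<open>A slab has thickness \<open>h\<close> in direction \<open>i\<close> and side
    \<open>2 * L\<close> in all others, hence the fraction \<open>h / (2 * L)\<close> of the volume
    of \<open>Q\<close>. Both positions, inside the lower face and outside the upper face, are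
    treated at once.\<close>
  have slab: "\<bar>integral (cbox p q) f\<bar> \<le> B * (h / (2 * L) * measure lborel Q)"
    if h: "0 < h" "h < L / 2"
      and pq: "\<And>j. j \<noteq> i \<Longrightarrow> p $ j = - L" "\<And>j. j \<noteq> i \<Longrightarrow> q $ j = L"
      and i: "(p $ i = - L \<and> q $ i = - L + h) \<or> (p $ i = L \<and> q $ i = L + h)"
    for h and p q :: "real^'n"
  proof -
    have ne: "cbox p q \<noteq> {}"
      unfolding interval_ne_empty_cart
    proof
      show "p $ j \<le> q $ j" for j
        using pq[of j] i h L by (cases "j = i") auto
    qed
    have neQ: "Q \<noteq> {}"
      using L by (simp add: Q_def interval_ne_empty_cart)
    have "measure lborel (cbox p q) = (q $ i - p $ i) * (\<Prod>j\<in>UNIV - {i}. q $ j - p $ j)"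
      by (simp add: content_cbox_cart[OF ne] prod.remove[of UNIV i])
    also have "\<dots> = h * (\<Prod>j\<in>UNIV - {i}. 2 * L)"
      using pq i by (auto intro!: prod.cong)
    finally have "measure lborel (cbox p q) = h * (\<Prod>j\<in>UNIV - {i}. 2 * L)" .
    moreover have "measure lborel Q = (2 * L) * (\<Prod>j\<in>UNIV - {i}. 2 * L)"
      using neQ unfolding Q_def
      by (subst content_cbox_cart) (simp_all add: prod.remove[of UNIV i] del: prod_constant)
    ultimately have content: "measure lborel (cbox p q) = h / (2 * L) * measure lborel Q"
      using L by simp
    have "norm (integral (cbox p q) f) \<le> B * measure lborel (cbox p q)"
    proof (rule has_integral_bound[OF \<open>B \<ge> 0\<close> integrable_integral[OF int]])
      fix u assume "u \<in> cbox p q"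
      then have u: "p $ j \<le> u $ j" "u $ j \<le> q $ j" for j
        by (auto simp: mem_box_cart)
      \<comment> \<open>Since \<open>h < L / 2\<close>, no coordinate exceeds \<open>2 * L\<close>;
        summing over the coordinates gives the outer radius of the shell.\<close>
      have coord: "\<bar>u $ j\<bar> \<le> 2 * L" for j
        using u[of j] pq[of j] i h by (cases "j = i") auto
      have "norm u \<le> (\<Sum>j\<in>UNIV. \<bar>u $ j\<bar>)"
        by (rule norm_le_l1_cart)
      also have "\<dots> \<le> (\<Sum>j\<in>(UNIV::'n set). 2 * L)"
        by (rule sum_mono) (rule coord)
      finally have "norm u \<le> 2 * real CARD('n) * L"
        by (simp add: mult_ac)
      \<comment> \<open>The coordinate in the thin direction stays within \<open>h < L / 2\<close>
        of \<open>L\<close> or \<open>- L\<close>, which gives the inner radius.\<close>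
      moreover have "L / 2 \<le> \<bar>u $ i\<bar>"
        using u[of i] i h by auto
      then have "L / 2 \<le> norm u"
        using component_le_norm_cart order_trans by blast
      ultimately show "norm (f u) \<le> B"
        using B[of u] by simp
    qed
    then show ?thesis
      by (simp add: content)
  qed
  have "\<bar>F (0 + h) - F 0\<bar> \<le> (B / L * measure lborel Q) * h" if h: "0 < h" "h < L / 2" for h
  proof -
    define a b :: "real^'n" where "a = (\<chi> j. - L)" and "b = (\<chi> j. L)"
    \<comment> \<open>\<open>U\<close> is the smallest box containing \<open>Q\<close> and its
      translate. Cutting it at height \<open>L\<close> gives \<open>Q\<close> and the upper slab,
      cutting it at \<open>- L + h\<close> gives the lower slab and the translate. Equating the two
      decompositions turns \<open>F h - F 0\<close> into the difference of the slab
      integrals.\<close>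
    define U where "U = cbox a (b + h *\<^sub>R e)"
    define p q :: "real^'n" where "p = (\<chi> j. if j = i then L else - L)"
      and "q = (\<chi> j. if j = i then - L + h else L)"
    have nth: "x \<bullet> e = x $ i" for x
      by (simp add: e_def inner_axis)
    have e: "e $ j = (if j = i then 1 else 0)" for j
      by (simp add: e_def axis_def)
    have eB: "e \<in> Basis"
      by (simp add: e_def axis_in_Basis_iff)
    have split: "cbox v w \<inter> {x. x $ i \<le> r} = cbox v (\<chi> j. if j = i then min (w $ i) r else w $ j)"
        "cbox v w \<inter> {x. x $ i \<ge> r} = cbox (\<chi> j. if j = i then max (v $ i) r else v $ j) w"
      for v w :: "real^'n" and r
      using interval_split_cart[where a=v and b=w and k=i and c=r] by (simp_all add: interval_cbox_cart)
    have upper: "U \<inter> {x. x \<bullet> e \<le> L} = Q" "U \<inter> {x. x \<bullet> e \<ge> L} = cbox p (b + h *\<^sub>R e)"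
      unfolding U_def Q_def nth split
      by (rule arg_cong2[where f=cbox]; use h L in \<open>simp add: vec_eq_iff a_def b_def p_def e\<close>)+
    have lower: "U \<inter> {x. x \<bullet> e \<le> - L + h} = cbox a q"
        "U \<inter> {x. x \<bullet> e \<ge> - L + h} = cbox (a + h *\<^sub>R e) (b + h *\<^sub>R e)"
      unfolding U_def nth split
      by (rule arg_cong2[where f=cbox]; use h L in \<open>simp add: vec_eq_iff a_def b_def q_def e\<close>)+
    have "F h = integral (cbox (a + h *\<^sub>R e) (b + h *\<^sub>R e)) f"
      using integral_shift_cbox[of "a + h *\<^sub>R e" "h *\<^sub>R e" "b + h *\<^sub>R e" f]
      by (simp add: F_def Q_def a_def b_def)
    moreover have "F 0 = integral Q f"
      by (simp add: F_def)
    moreover have "integral U f = integral Q f + integral (cbox p (b + h *\<^sub>R e)) f"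
      unfolding upper[symmetric] U_def by (rule integral_split[OF int eB])
    moreover have "integral U f =
        integral (cbox a q) f + integral (cbox (a + h *\<^sub>R e) (b + h *\<^sub>R e)) f"
      unfolding lower[symmetric] U_def by (rule integral_split[OF int eB])
    moreover have "\<bar>integral (cbox p (b + h *\<^sub>R e)) f\<bar> \<le> B * (h / (2 * L) * measure lborel Q)"
      by (rule slab[OF h]) (auto simp: p_def b_def e)
    moreover have "\<bar>integral (cbox a q) f\<bar> \<le> B * (h / (2 * L) * measure lborel Q)"
      by (rule slab[OF h]) (auto simp: q_def a_def)
    ultimately have "\<bar>F h - F 0\<bar> \<le> 2 * (B * (h / (2 * L) * measure lborel Q))"
      by linarith
    also have "\<dots> = (B / L * measure lborel Q) * h"
      using L by (simp add: field_simps)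
    finally show ?thesis by simp
  qed
  then show ?thesis
    using abs_derivative_le_of_right_lipschitz[OF deriv, of "L / 2"] L by simp
qed

section \<open>Fields of constant divergence\<close>

lemma constant_divergence_bound:
  fixes X :: "real^'n::finite \<Rightarrow> real^'n"
  assumes X: "\<And>i. C1_function (\<lambda>u. X u $ i)" and div: "\<And>u. divergence X u = c"
    and L: "L > 0" and "B \<ge> 0"
    and B: "\<And>u. L / 2 \<le> norm u \<Longrightarrow> norm u \<le> 2 * real CARD('n) * L \<Longrightarrow> norm (X u) \<le> B"
  shows "\<bar>c\<bar> \<le> real CARD('n) * B / L"
proof -
  define Q :: "(real^'n) set" where "Q = cbox (\<chi> j. - L) (\<chi> j. L)"
  have "Q \<noteq> {}"
    using L by (simp add: Q_def interval_ne_empty_cart)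
  then have pos: "measure lborel Q > 0"
    unfolding Q_def by (subst content_cbox_cart) (use L in \<open>auto intro!: prod_pos\<close>)
  have "(\<lambda>u. partial_deriv i (\<lambda>v. X v $ i) u) integrable_on Q" for i
    unfolding Q_def using X[of i]
    by (intro integrable_continuous) (auto simp: C1_function_def intro: continuous_on_subset)
  \<comment> \<open>The integral of the divergence is evaluated in two ways, coordinate by
    coordinate and as \<open>c\<close> times the volume of \<open>Q\<close>; the volume cancels at
    the end.\<close>
  then have "integral Q (divergence X) = (\<Sum>i\<in>UNIV. integral Q (partial_deriv i (\<lambda>v. X v $ i)))"
    unfolding divergence_def[abs_def] by (intro integral_sum) auto
  moreover have "integral Q (divergence X) = c * measure lborel Q"
    by (simp add: ext[of "divergence X" "\<lambda>u. c", OF div] Q_def)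
  ultimately have "\<bar>c * measure lborel Q\<bar> \<le> (\<Sum>i\<in>UNIV. \<bar>integral Q (partial_deriv i (\<lambda>v. X v $ i))\<bar>)"
    by (metis sum_abs)
  also have "\<dots> \<le> (\<Sum>i\<in>(UNIV::'n set). B / L * measure lborel Q)"
    unfolding Q_def
    by (rule sum_mono, rule integral_partial_deriv_cube_bound[OF X L \<open>B \<ge> 0\<close>])
      (rule order_trans[OF component_le_norm_cart B])
  finally have "\<bar>c\<bar> * measure lborel Q \<le> (real CARD('n) * B / L) * measure lborel Q"
    using pos by (simp add: abs_mult)
  then show ?thesis
    using pos by (simp only: mult_le_cancel_right_pos)
qed

text \<open>On the shell of scale \<open>L\<close> the field is of order at most
  \<open>L powr k\<close>, so the preceding bound on \<open>c\<close> is of order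
  \<open>L powr (k - 1)\<close> and vanishes as \<open>L\<close> grows. The origin is excluded from
  the growth condition because \<open>0 powr k = 0\<close> would force
  \<open>X 0 = 0\<close>.\<close>

lemma sublinear_constant_divergence_eq_0:
  fixes X :: "real^'n::finite \<Rightarrow> real^'n"
  assumes X: "\<And>i. C1_function (\<lambda>u. X u $ i)" and div: "\<And>u. divergence X u = c"
    and "M \<ge> 0" and "k < 1"
    and growth: "\<And>u. u \<noteq> 0 \<Longrightarrow> norm (X u) \<le> M * norm u powr k"
  shows "c = 0"
proof -
  \<comment> \<open>On the shell, \<open>norm u powr k\<close> is largest at the outer radius if
    \<open>k\<close> is nonnegative and at the inner radius otherwise; the sum of the two values
    covers both signs.\<close>
  define C where "C = (2 * real CARD('n)) powr k + (1 / 2) powr k"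
  have bound: "\<bar>c\<bar> \<le> real CARD('n) * M * C * L powr (k - 1)" if L: "L > 0" for L
  proof -
    have "norm (X u) \<le> M * (C * L powr k)"
      if u: "L / 2 \<le> norm u" "norm u \<le> 2 * real CARD('n) * L" for u
    proof -
      have "norm u powr k \<le> (2 * real CARD('n) * L) powr k + (L / 2) powr k"
      proof (cases "k \<ge> 0")
        case True
        then have "norm u powr k \<le> (2 * real CARD('n) * L) powr k"
          using u by (intro powr_mono2) auto
        then show ?thesis
          by (simp add: add_increasing2)
      next
        case False
        then have "norm u powr k \<le> (L / 2) powr k"
          using u L by (intro powr_mono2') auto
        then show ?thesis
          by (simp add: add_increasing)
      qed
      also have "\<dots> = C * L powr k"
        using L by (simp add: C_def powr_mult powr_divide field_simps)
      finally have "M * norm u powr k \<le> M * (C * L powr k)"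
        using \<open>M \<ge> 0\<close> by (rule mult_left_mono)
      moreover have "u \<noteq> 0"
        using u L by auto
      ultimately show ?thesis
        using growth[of u] by linarith
    qed
    then have "\<bar>c\<bar> \<le> real CARD('n) * (M * (C * L powr k)) / L"
      using \<open>M \<ge> 0\<close> by (intro constant_divergence_bound[OF X div L]) (auto simp: C_def)
    also have "\<dots> = real CARD('n) * M * C * L powr (k - 1)"
      using L by (simp add: powr_diff)
    finally show ?thesis .
  qed
  have "((\<lambda>L. real CARD('n) * M * C * L powr (k - 1)) \<longlongrightarrow> real CARD('n) * M * C * 0) at_top"
    using \<open>k < 1\<close> by (intro tendsto_mult_left tendsto_neg_powr filterlim_ident) auto
  moreover have "\<forall>\<^sub>F L in at_top. \<bar>c\<bar> \<le> real CARD('n) * M * C * L powr (k - 1)"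
    using eventually_gt_at_top[of 0] by eventually_elim (rule bound)
  ultimately have "\<bar>c\<bar> \<le> real CARD('n) * M * C * 0"
    by (rule tendsto_lowerbound) simp
  then show ?thesis by simp
qed

section \<open>Application to the normalized gradient field of the graph\<close>

theorem corollary2p4:
  fixes \<psi> :: "real^'n::finite \<Rightarrow> real" and M \<epsilon> :: real
  assumes "C2_function \<psi>"
    and "spacelike_graph \<psi> \<or> timelike_graph \<psi>"
    and "mean_curvature \<psi> constant_on UNIV"
    and "M > 0" and "\<epsilon> > 0"
    and "\<forall>u. ereal (norm (grad \<psi> u) / sqrt \<bar>1 - (norm (grad \<psi> u))\<^sup>2\<bar>)
               \<le> ereal M * ext_power (\<Sum>i\<in>UNIV. (u $ i)\<^sup>2) (1/2 - \<epsilon>)"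
  shows "\<forall>u. mean_curvature \<psi> u = 0"
proof -
  define q where "q u = (norm (grad \<psi> u))\<^sup>2" for u
  define X where "X u = (1 / sqrt \<bar>1 - q u\<bar>) *\<^sub>R grad \<psi> u" for u
  have diff: "\<psi> differentiable (at u)" for u
    using assms(1) by (simp add: C2_function_def)
  have C1: "C1_function (\<lambda>u. grad \<psi> u $ i)" for i
    using assms(1) by (simp add: C2_function_def grad_def)
  \<comment> \<open>As a polynomial in the components of the gradient, \<open>q\<close> is C1 even
    where the gradient vanishes and the norm is not differentiable.\<close>
  have "q = (\<lambda>u. \<Sum>i\<in>UNIV. grad \<psi> u $ i * grad \<psi> u $ i)"
    by (rule ext) (simp add: q_def power2_norm_eq_inner inner_vec_def)
  then have q_C1: "C1_function q"
    by (simp only:) (intro C1_function_sum C1_function_mult C1)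
  \<comment> \<open>The second case records the failure of \<open>spacelike_graph\<close>, since
    this is the test that selects the branch in \<open>mean_curvature\<close>.\<close>
  consider (space) "spacelike_graph \<psi>" "\<And>u. q u < 1"
    | (time) "\<not> spacelike_graph \<psi>" "\<And>u. q u > 1"
  proof (cases "spacelike_graph \<psi>")
    case True
    then have "q u < 1" for u
      by (simp add: q_def spacelike_graph_iff[OF diff] power_less_one_iff)
    with True show ?thesis by (rule that(1))
  next
    case False
    then have "norm (grad \<psi> u) > 1" for u
      using assms(2) timelike_graph_iff[OF diff] by blast
    then have "q u > 1" for u
      by (simp add: q_def one_less_power)
    with False show ?thesis by (rule that(2))
  qed
  then have "(\<forall>i. C1_function (\<lambda>u. X u $ i)) \<and>
      (\<forall>u. mean_curvature \<psi> u = divergence X u / real CARD('n))"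
  proof cases
    case space
    \<comment> \<open>The radicand is written with \<open>+\<close> and \<open>(-1) *\<close> so
      that the closure lemmas for sums, products and constants apply directly.\<close>
    have eq: "X = (\<lambda>u. (1 / sqrt (1 + (-1) * q u)) *\<^sub>R grad \<psi> u)"
      by (rule ext) (use space(2) in \<open>simp add: X_def abs_of_pos\<close>)
    have w: "C1_function (\<lambda>u. 1 / sqrt (1 + (-1) * q u))"
      using space
      by (intro C1_function_inverse_sqrt C1_function_add C1_function_mult C1_function_const q_C1) auto
    have "C1_function (\<lambda>u. X u $ i)" for i
      unfolding eq vector_scaleR_component real_scaleR_def by (intro C1_function_mult C1 w)
    moreover have "mean_curvature \<psi> u = divergence X u / real CARD('n)" for u
      using space by (simp add: mean_curvature_def eq q_def)
    ultimately show ?thesis by blast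
  next
    case time
    have eq: "X = (\<lambda>u. (1 / sqrt (q u + (-1))) *\<^sub>R grad \<psi> u)"
      by (rule ext) (use time(2) in \<open>simp add: X_def abs_of_neg\<close>)
    have w: "C1_function (\<lambda>u. 1 / sqrt (q u + (-1)))"
      using time
      by (intro C1_function_inverse_sqrt C1_function_add C1_function_const q_C1) auto
    have "C1_function (\<lambda>u. X u $ i)" for i
      unfolding eq vector_scaleR_component real_scaleR_def by (intro C1_function_mult C1 w)
    moreover have "mean_curvature \<psi> u = divergence X u / real CARD('n)" for u
      using time by (simp add: mean_curvature_def eq q_def)
    ultimately show ?thesis by blast
  qed
  then have X: "C1_function (\<lambda>u. X u $ i)"
    and H: "mean_curvature \<psi> u = divergence X u / real CARD('n)" for i u
    by blast+
  have growth: "norm (X u) \<le> M * norm u powr (1 - 2 * \<epsilon>)" if "u \<noteq> 0" for u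
  proof -
    \<comment> \<open>With the squared norm written as a \<open>powr\<close>, the exponents
      multiply: 2 (1/2 - \<epsilon>) = 1 - 2 \<epsilon>, which is less than 1.\<close>
    have sq: "(\<Sum>i\<in>UNIV. (u $ i)\<^sup>2) = norm u powr 2"
      using that by (simp add: norm_vec_def L2_set_def sum_nonneg)
    have "(\<Sum>i\<in>UNIV. (u $ i)\<^sup>2) \<noteq> 0"
      unfolding sq using that by simp
    then have "ext_power (\<Sum>i\<in>UNIV. (u $ i)\<^sup>2) (1/2 - \<epsilon>) = ereal (norm u powr (1 - 2 * \<epsilon>))"
      unfolding ext_power_def sq by (simp add: powr_powr right_diff_distrib del: powr_numeral)
    with assms(6)[rule_format, of u] show ?thesis
      by (simp add: X_def q_def)
  qed
  obtain c where "\<And>u. mean_curvature \<psi> u = c"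
    using assms(3) by (auto simp: constant_on_def)
  then have "divergence X u = c * real CARD('n)" for u
    using H[of u] by simp
  from sublinear_constant_divergence_eq_0[OF X this _ _ growth]
  have "c * real CARD('n) = 0"
    using assms(4,5) by simp
  then show ?thesis
    using \<open>\<And>u. mean_curvature \<psi> u = c\<close> by simp
qed

end
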